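(* If $G$ is a graph with diameter $2$, then $a_u(G)\le 2$. Moreover, if $G$ is a graph with diameter $2$ that is neither (isomorphic to) the cycle $C_5$ nor the Petersen graph, then $a_u(G)=1$; that is, equality $a_u(G)=2$ can hold only for $C_5$ or possibly the Petersen graph.
   Context: Graphs are finite, simple and undirected. The vertices of a graph carry nonnegative integer weights. A unit acquisition move transfers one unit of weight from a vertex $u$ of positive weight to a neighbor $v$ of $u$, under the condition that before the move the weight of $v$ is at least the weight of $u$. The unit acquisition number $a_u(G)$ is the minimum size to which the set of vertices with positive weight can be reduced via successive unit acquisition moves, starting from the configuration in which every vertex has weight $1$. *)

theory Defs
  imports "Graph_Theory.Graph_Theory"
begin

text \<open>
  A finite simple undirected graph is a \<open>pair_graph\<close>: a finite vertex set \<open>pverts G\<close> and a symmetric,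
  irreflexive arc relation \<open>parcs G\<close>, each edge being represented by its two orientations.
\<close>

text \<open>Every arc has length 1, and the distance between vertices in different components is \<open>\<infinity>\<close>.\<close>

definition graph_dist :: "'a pair_pre_digraph \<Rightarrow> 'a \<Rightarrow> 'a \<Rightarrow> ereal" where
  "graph_dist G u v = wf_digraph.\<mu> (with_proj G) (\<lambda>_. 1) u v"

definition graph_diameter :: "'a pair_pre_digraph \<Rightarrow> ereal" where
  "graph_diameter G = (SUP (u, v) \<in> pverts G \<times> pverts G. graph_dist G u v)"

text \<open>
  As tails and heads are \<open>fst\<close> and \<open>snd\<close> on both sides, the arc map of such an isomorphism is
  determined by the vertex map: it is a vertex bijection carrying \<open>parcs G\<close> onto \<open>parcs H\<close>.
\<close>

definition graph_iso :: "'a pair_pre_digraph \<Rightarrow> 'b pair_pre_digraph \<Rightarrow> bool" where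
  "graph_iso G H \<longleftrightarrow> digraph_iso (with_proj G) (with_proj H)"

text \<open>This is the cycle \<open>C\<^sub>n\<close> for \<open>n \<ge> 3\<close>.\<close>

definition cycle_graph :: "nat \<Rightarrow> nat pair_pre_digraph" where
  "cycle_graph n =
    \<lparr> pverts = {..<n},
      parcs = {(i, j). i < n \<and> j < n \<and> (j = Suc i mod n \<or> i = Suc j mod n)} \<rparr>"

text \<open>The Petersen graph as the Kneser graph on the 2-element subsets of a 5-element set.\<close>

definition petersen_graph :: "nat set pair_pre_digraph" where
  "petersen_graph =
    \<lparr> pverts = {A. A \<subseteq> {..<5} \<and> card A = 2},
      parcs = {(A, B). A \<subseteq> {..<5} \<and> card A = 2 \<and> B \<subseteq> {..<5} \<and> card B = 2 \<and> A \<inter> B = {}} \<rparr>"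

definition unit_acquisition_move ::
    "'a pair_pre_digraph \<Rightarrow> ('a \<Rightarrow> nat) \<Rightarrow> ('a \<Rightarrow> nat) \<Rightarrow> bool" where
  "unit_acquisition_move G w w' \<longleftrightarrow>
    (\<exists>u v. (u, v) \<in> parcs G \<and> 0 < w u \<and> w u \<le> w v \<and> w' = w(u := w u - 1, v := w v + 1))"

text \<open>Elements that are not vertices carry weight 0.\<close>

definition initial_weight :: "'a pair_pre_digraph \<Rightarrow> 'a \<Rightarrow> nat" where
  "initial_weight G v = (if v \<in> pverts G then 1 else 0)"

definition unit_acquisition_number :: "'a pair_pre_digraph \<Rightarrow> nat" where
  "unit_acquisition_number G =
    (LEAST k. \<exists>w. (unit_acquisition_move G)\<^sup>*\<^sup>* (initial_weight G) w
      \<and> card {v \<in> pverts G. 0 < w v} = k)"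

end

theory Submission
  imports Defs
begin

text \<open>
  Fix a root \<open>r\<close> and let it absorb the unit of a neighbour \<open>y\<close>. From then on \<open>r\<close> has weight at
  least 2, and a vertex \<open>x\<close> at distance 2 can send its unit to \<open>r\<close> through any neighbour \<open>z\<close> of \<open>r\<close> that
  still has weight 1: the relay \<open>x \<rightarrow> z \<rightarrow> r\<close> leaves \<open>z\<close> unchanged. A vertex of weight 0 never receives
  anything again, so \<open>y\<close> is lost as a relay. The only vertices that this hurts are the private
  neighbours of \<open>y\<close>: those at distance 2 from \<open>r\<close> that see \<open>r\<close> through \<open>y\<close> alone. If some arc has no
  private neighbours, then everything ends at \<open>r\<close> and the unit acquisition number is 1. Call a
  graph stubborn if this number is not 1. In a stubborn graph every ordered pair of adjacent vertices therefore has private neighbours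
  (\<open>private_nonempty\<close>).

  Private neighbours can be rescued by a longer relay \<open>x \<rightarrow> u \<rightarrow> a \<rightarrow> r\<close> through another neighbour \<open>a\<close>
  of \<open>r\<close> and a neighbour \<open>u\<close> of \<open>a\<close>. This works as soon as \<open>a\<close> has weight 2 and \<open>r\<close> has weight 3; to
  bring \<open>a\<close> to weight 2, one neighbour \<open>b\<close> of \<open>a\<close> is sacrificed (\<open>concentrate_branch\<close>). Hence a
  stubborn graph has no \<open>b\<close> such that every private neighbour has such a \<open>u\<close> different from \<open>b\<close>
  (\<open>no_branch\<close>).

  This excludes triangles: in a triangle \<open>r, a, b\<close> the vertex \<open>b\<close> can be sacrificed. It also excludes
  4-cycles: if no neighbour of \<open>z\<close> can be sacrificed, then each of them is the only link from some
  private neighbour of \<open>y\<close> to \<open>z\<close>, so the branch at \<open>z\<close> has at most as many leaves as \<open>y\<close> has private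
  neighbours; with the roles of \<open>y\<close> and \<open>z\<close> exchanged, counting shows that \<open>y\<close> and \<open>z\<close> have no
  common neighbour but \<open>r\<close>. A stubborn graph thus is a Moore graph of diameter 2 and girth 5, and as
  such regular. There the sacrifice of \<open>b\<close> costs just one private neighbour \<open>a\<close>
  (\<open>concentrate_leaving_one\<close>), which gives the bound 2; in degree at least 4 a second branch is available
  to rescue \<open>a\<close> as well. What remains are the degrees 2 and 3, where adjacency is forced vertex by
  vertex to be that of \<open>C\<^sub>5\<close> and of the Petersen graph.
\<close>

section \<open>Moving weight to a root\<close>

context pair_graph
begin

definition nb :: "'a \<Rightarrow> 'a set" where
  "nb v = {u. (v, u) \<in> parcs G}"

lemma nb_sym: "u \<in> nb v \<Longrightarrow> v \<in> nb u"
  using pair_sym_arcs by (auto simp: nb_def symmetric_def elim: symE)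

lemma nb_irrefl [simp]: "v \<notin> nb v"
  using no_loops[of "(v, v)"] by (auto simp: nb_def)

lemma nb_verts: "u \<in> nb v \<Longrightarrow> u \<in> pverts G"
  by (auto simp: nb_def dest: in_arcsD2)

lemma nb_verts': "u \<in> nb v \<Longrightarrow> v \<in> pverts G"
  by (auto simp: nb_def dest: in_arcsD1)

lemma finite_nb [simp]: "finite (nb v)"
  by (rule finite_subset[OF _ pair_finite_verts]) (auto dest: nb_verts)

abbreviation reach :: "('a \<Rightarrow> nat) \<Rightarrow> ('a \<Rightarrow> nat) \<Rightarrow> bool" where
  "reach \<equiv> (unit_acquisition_move G)\<^sup>*\<^sup>*"

lemma reach_move:
  assumes "u \<in> nb v" "0 < w u" "w u \<le> w v" "w' = w(u := w u - 1, v := w v + 1)"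
  shows "reach w w'"
  using assms nb_sym[of u v] unfolding unit_acquisition_move_def nb_def
  by (intro r_into_rtranclp) auto

lemma reach_relay:
  assumes "x \<in> nb y" "y \<in> nb r" "x \<noteq> r" "0 < w x" "w x \<le> w y" "w y < w r"
    and w': "w' = w(x := w x - 1, r := w r + 1)"
  shows "reach w w'"
proof -
  define w1 where "w1 = w(x := w x - 1, y := w y + 1)"
  have "x \<noteq> y" "y \<noteq> r" using assms by auto
  then have w1: "w1 y = w y + 1" "w1 r = w r" using \<open>x \<noteq> r\<close> by (auto simp: w1_def)
  have "w' = w1(y := w1 y - 1, r := w1 r + 1)"
    using w1 \<open>x \<noteq> y\<close> \<open>y \<noteq> r\<close> \<open>x \<noteq> r\<close> by (auto simp: w' w1_def fun_eq_iff)
  then have "reach w1 w'" using assms(2,6) w1 by (intro reach_move[of y r]) auto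
  moreover have "reach w w1" using assms by (intro reach_move) (auto simp: w1_def)
  ultimately show ?thesis by simp
qed

lemma reach_relay2:
  assumes "x \<in> nb u" "u \<in> nb a" "a \<in> nb r" "x \<noteq> a" "x \<noteq> r" "u \<noteq> r"
    and "0 < w x" "w x \<le> w u" "w u < w a" "w a < w r"
    and w': "w' = w(x := w x - 1, r := w r + 1)"
  shows "reach w w'"
proof -
  define w1 where "w1 = w(x := w x - 1, u := w u + 1)"
  have "x \<noteq> u" "u \<noteq> a" "a \<noteq> r" using assms by auto
  then have w1: "w1 u = w u + 1" "w1 a = w a" "w1 r = w r"
    using assms by (auto simp: w1_def)
  have "w' = w1(u := w1 u - 1, r := w1 r + 1)"
    using w1 \<open>x \<noteq> u\<close> \<open>u \<noteq> r\<close> \<open>x \<noteq> r\<close> by (auto simp: w' w1_def fun_eq_iff)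
  then have "reach w1 w'" using assms w1 by (intro reach_relay[of u a r]) auto
  moreover have "reach w w1" using assms by (intro reach_move) (auto simp: w1_def)
  ultimately show ?thesis by simp
qed

definition gather :: "('a \<Rightarrow> nat) \<Rightarrow> 'a \<Rightarrow> 'a set \<Rightarrow> 'a \<Rightarrow> nat" where
  "gather w r X v = (if v = r then w r + card X else if v \<in> X then w v - 1 else w v)"

text \<open>
  A set of vertices each of which can send one unit to \<open>r\<close> can do so one after the other. The step is
  required for every \<open>Y\<close> that may have gone before, so the order is immaterial.
\<close>
lemma reach_gather:
  assumes "finite X" "r \<notin> X"
    and step: "\<And>x Y w1 w2. Y \<subseteq> X \<Longrightarrow> x \<in> X \<Longrightarrow> x \<notin> Y \<Longrightarrow> w1 = gather w r Y \<Longrightarrow>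
      w2 = w1(x := w1 x - 1, r := w1 r + 1) \<Longrightarrow> reach w1 w2"
  shows "reach w (gather w r X)"
proof -
  have "reach w (gather w r F)" if "finite F" "F \<subseteq> X" for F
    using that
  proof (induction F rule: finite_induct)
    case empty
    have "gather w r {} = w" by (auto simp: gather_def)
    then show ?case by simp
  next
    case (insert x F)
    have "r \<noteq> x" "r \<notin> F" using insert \<open>r \<notin> X\<close> by auto
    then have "gather w r (insert x F) =
        (gather w r F)(x := gather w r F x - 1, r := gather w r F r + 1)"
      using insert.hyps by (auto simp: gather_def fun_eq_iff)
    with insert have "reach (gather w r F) (gather w r (insert x F))"
      by (intro step[of F x]) auto
    moreover have "reach w (gather w r F)" using insert by simp
    ultimately show ?case by simp
  qed
  then show ?thesis using assms by simp
qed

text \<open>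
  All strategies below run through configurations of this form: the vertices of \<open>K\<close> still have their
  initial unit, and \<open>r \<notin> K\<close> holds the units of all the others, its own included. Such a configuration
  is determined by \<open>r\<close> and \<open>K\<close>, so a strategy is a shrinking sequence of sets \<open>K\<close>.
\<close>
definition concentrated :: "'a \<Rightarrow> 'a set \<Rightarrow> 'a \<Rightarrow> nat" where
  "concentrated r K v = (if v = r then card (pverts G - K) else if v \<in> K then 1 else 0)"

lemma initial_concentrated:
  assumes "r \<in> pverts G"
  shows "initial_weight G = concentrated r (pverts G - {r})"
proof -
  have "pverts G - (pverts G - {r}) = {r}" using assms by auto
  then show ?thesis using assms by (auto simp: initial_weight_def concentrated_def fun_eq_iff)
qed

lemma gather_concentrated:
  assumes "K \<subseteq> pverts G - {r}" "X \<subseteq> K"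
  shows "gather (concentrated r K) r X = concentrated r (K - X)"
proof -
  have "pverts G - (K - X) = (pverts G - K) \<union> X" using assms by auto
  moreover have "card ((pverts G - K) \<union> X) = card (pverts G - K) + card X"
    using assms finite_subset[of X "pverts G"] pair_finite_verts
    by (intro card_Un_disjoint) auto
  ultimately show ?thesis using assms by (auto simp: gather_def concentrated_def fun_eq_iff)
qed

lemma concentrate_adjacent:
  assumes "r \<in> pverts G" "K \<subseteq> pverts G - {r}" "X \<subseteq> K \<inter> nb r"
  shows "reach (concentrated r K) (concentrated r (K - X))"
proof -
  have "card (pverts G - K) > 0"
    using assms pair_finite_verts by (subst card_gt_0_iff) auto
  have "reach (concentrated r K) (gather (concentrated r K) r X)"
  proof (rule reach_gather)
    fix x Y w1 w2
    assume *: "Y \<subseteq> X" "x \<in> X" "x \<notin> Y" "w1 = gather (concentrated r K) r Y"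
      "w2 = w1(x := w1 x - 1, r := w1 r + 1)"
    have "x \<noteq> r" "x \<in> nb r" "x \<in> K" using * assms by auto
    then show "reach w1 w2"
      using * \<open>card (pverts G - K) > 0\<close> by (intro reach_move) (auto simp: gather_def concentrated_def)
  qed (use assms in \<open>auto intro: finite_subset[OF _ finite_nb]\<close>)
  then show ?thesis using assms gather_concentrated[of K r X] by auto
qed

text \<open>
  A relay \<open>y\<close> of weight 1 rises to weight 2 and drops back to 1, so a single \<open>y\<close> serves all of \<open>X\<close>. It
  may pass on its second unit because the root has weight at least 2.
\<close>
lemma concentrate_relay:
  assumes K: "K \<subseteq> pverts G - {r}" and X: "X \<subseteq> K - nb r" and two: "2 \<le> card (pverts G - K)"
    and y: "\<And>x. x \<in> X \<Longrightarrow> \<exists>y \<in> nb x \<inter> nb r. y \<in> K"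
  shows "reach (concentrated r K) (concentrated r (K - X))"
proof -
  have "finite X" using K X pair_finite_verts by (meson Diff_subset finite_subset order_trans)
  have "reach (concentrated r K) (gather (concentrated r K) r X)"
  proof (rule reach_gather)
    fix x Y w1 w2
    assume *: "Y \<subseteq> X" "x \<in> X" "x \<notin> Y" "w1 = gather (concentrated r K) r Y"
      "w2 = w1(x := w1 x - 1, r := w1 r + 1)"
    then obtain y where "y \<in> nb x" "y \<in> nb r" "y \<in> K" using y by blast
    moreover have "x \<noteq> r" "y \<noteq> r" "x \<in> K" "y \<notin> Y" using * K X \<open>y \<in> K\<close> \<open>y \<in> nb r\<close> by auto
    ultimately show "reach w1 w2"
      using * two nb_sym[of y x] by (intro reach_relay[of x y r])
        (auto simp: gather_def concentrated_def)
  qed (use K X \<open>finite X\<close> in auto)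
  moreover have "X \<subseteq> K" using X by auto
  ultimately show ?thesis using K gather_concentrated[of K r X] by simp
qed

text \<open>
  The unit of \<open>b\<close> lifts \<open>a\<close> to weight 2. As the root has weight at least 3, each unit of \<open>S\<close> can then
  travel through \<open>T\<close> and \<open>a\<close> to the root, and both keep their weights 1 and 2. Afterwards \<open>T\<close> is
  emptied through \<open>a\<close>, and \<open>a\<close> itself gives up its two units.
\<close>
lemma concentrate_branch:
  assumes K: "K \<subseteq> pverts G - {r}" and three: "3 \<le> card (pverts G - K)"
    and a: "a \<in> nb r" "a \<in> K" and b: "b \<in> nb a" "b \<in> K"
    and ST: "S \<subseteq> K - {a, b}" "T \<subseteq> K - {a, b}" "S \<inter> T = {}" "T \<subseteq> nb a"
    and dom: "\<And>x. x \<in> S \<Longrightarrow> \<exists>u \<in> T. u \<in> nb x"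
  shows "reach (concentrated r K) (concentrated r (K - insert a (insert b (S \<union> T))))"
proof -
  have "finite K" using K pair_finite_verts by (meson Diff_subset finite_subset order_trans)
  have "S \<subseteq> K" "T \<subseteq> K" using ST by auto
  then have fin: "finite S" "finite T" using \<open>finite K\<close> by (auto intro: finite_subset)
  have ne: "r \<notin> K" "a \<noteq> r" "b \<noteq> r" "a \<noteq> b" "a \<notin> S" "a \<notin> T" "b \<notin> S" "b \<notin> T" "r \<notin> S" "r \<notin> T"
    using a b K ST by auto
  define w0 where "w0 = concentrated r K"
  define w1 where "w1 = w0(b := 0, a := 2)"
  define w2 where "w2 = gather w1 r S"
  define w3 where "w3 = gather w2 r T"
  define w4 where "w4 = w3(a := w3 a - 1, r := w3 r + 1)"
  define w5 where "w5 = w4(a := w4 a - 1, r := w4 r + 1)"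
  have w0: "w0 v = (if v = r then card (pverts G - K) else if v \<in> K then 1 else 0)" for v
    by (simp add: w0_def concentrated_def)
  have w1: "w1 v = (if v = b then 0 else if v = a then 2 else w0 v)" for v
    using ne by (simp add: w1_def)
  have w3: "w3 a = 2" "w3 r \<ge> 3"
    using ne three by (auto simp: w3_def w2_def w1 w0 gather_def)
  have "reach w0 w1"
    using a b ne by (intro reach_move[of b a]) (auto simp: w1_def w0)
  also have "reach w1 w2"
    unfolding w2_def
  proof (rule reach_gather)
    fix x Y v1 v2
    assume *: "Y \<subseteq> S" "x \<in> S" "x \<notin> Y" "v1 = gather w1 r Y"
      "v2 = v1(x := v1 x - 1, r := v1 r + 1)"
    obtain u where u: "u \<in> T" "u \<in> nb x" using dom * by blast
    have x: "x \<in> K" "x \<noteq> a" "x \<noteq> b" "x \<noteq> r" "a \<notin> Y" using ST * ne by auto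
    have u': "u \<in> K" "u \<noteq> a" "u \<noteq> b" "u \<noteq> r" "u \<notin> Y" "u \<in> nb a" using ST u * ne by auto
    have "v1 x = 1" "v1 u = 1" "v1 a = 2" "v1 r \<ge> 3"
      using * x u' ne three by (auto simp: gather_def w1 w0)
    then show "reach v1 v2"
      using *(5) u(2) x u' a nb_sym[of u x] by (intro reach_relay2[of x u a r]) auto
  qed (use ne fin in auto)
  also have "reach w2 w3"
    unfolding w3_def
  proof (rule reach_gather)
    fix x Y v1 v2
    assume *: "Y \<subseteq> T" "x \<in> T" "x \<notin> Y" "v1 = gather w2 r Y"
      "v2 = v1(x := v1 x - 1, r := v1 r + 1)"
    have x: "x \<in> K" "x \<noteq> a" "x \<noteq> b" "x \<noteq> r" "x \<notin> S" "a \<notin> Y" "x \<in> nb a" using ST * ne by auto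
    have "v1 x = 1" "v1 a = 2" "v1 r \<ge> 3"
      using * x ne three by (auto simp: gather_def w2_def w1 w0)
    then show "reach v1 v2"
      using *(5) x a by (intro reach_relay[of x a r]) auto
  qed (use ne fin in auto)
  also have "reach w3 w4" using w3 a ne by (intro reach_move[of a r]) (auto simp: w4_def)
  also have "reach w4 w5" using w3 a ne by (intro reach_move[of a r]) (auto simp: w4_def w5_def)
  also have "w5 = gather w0 r (insert a (insert b (S \<union> T)))"
  proof -
    have "card (insert a (insert b (S \<union> T))) = card S + card T + 2"
      using fin ST ne by (simp add: card_Un_disjoint)
    moreover have "w5 v = (if v = r then w0 r + card S + card T + 2 else if v = a \<or> v = b then 0
        else if v \<in> S \<or> v \<in> T then w0 v - 1 else w0 v)" for v
      using ne ST by (auto simp: w5_def w4_def w3_def w2_def w1 gather_def)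
    ultimately show ?thesis
      using a b ne by (auto simp: gather_def w0 fun_eq_iff)
  qed
  also have "\<dots> = concentrated r (K - insert a (insert b (S \<union> T)))"
    unfolding w0_def using K a b ST by (intro gather_concentrated) auto
  finally show ?thesis unfolding w0_def .
qed

lemma unit_acquisition_number_le:
  assumes "reach (initial_weight G) (concentrated r K)" "r \<in> pverts G" "finite K"
  shows "unit_acquisition_number G \<le> Suc (card K)"
proof -
  have "unit_acquisition_number G \<le> card {v \<in> pverts G. 0 < concentrated r K v}"
    unfolding unit_acquisition_number_def using assms by (intro Least_le) blast
  also have "\<dots> \<le> card (insert r K)"
    using assms by (intro card_mono) (auto simp: concentrated_def split: if_splits)
  also have "\<dots> \<le> Suc (card K)" by (rule card_insert_le_m1) auto
  finally show ?thesis .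
qed

text \<open>
  The target of a move has positive weight afterwards, so some vertex always has.
\<close>
lemma unit_acquisition_number_pos:
  assumes "pverts G \<noteq> {}"
  shows "0 < unit_acquisition_number G"
proof -
  have pos: "\<exists>v \<in> pverts G. 0 < w v" if "reach (initial_weight G) w" for w
    using that
  proof induction
    case base
    then show ?case using assms by (auto simp: initial_weight_def)
  next
    case (step w w')
    then show ?case by (auto simp: unit_acquisition_move_def dest: in_arcsD2)
  qed
  let ?P = "\<lambda>k. \<exists>w. reach (initial_weight G) w \<and> card {v \<in> pverts G. 0 < w v} = k"
  have "\<exists>k. ?P k" by blast
  then have "?P (unit_acquisition_number G)"
    unfolding unit_acquisition_number_def by (rule LeastI_ex)
  then obtain w where w: "reach (initial_weight G) w"
    "card {v \<in> pverts G. 0 < w v} = unit_acquisition_number G" by blast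
  then have "{v \<in> pverts G. 0 < w v} \<noteq> {}" using pos by blast
  then have "0 < card {v \<in> pverts G. 0 < w v}" using pair_finite_verts by (simp add: card_gt_0_iff)
  then show ?thesis using w by simp
qed

end

section \<open>Private neighbours\<close>

text \<open>
  Diameter at most 2 in terms of common neighbours; the empty graph, which satisfies this vacuously,
  is excluded because its unit acquisition number is 0.
\<close>
locale diameter_le_2_graph = pair_graph G for G :: "'a pair_pre_digraph" +
  assumes nonempty: "pverts G \<noteq> {}"
    and common_nb: "\<lbrakk>u \<in> pverts G; v \<in> pverts G; u \<noteq> v; u \<notin> nb v\<rbrakk> \<Longrightarrow> \<exists>y. y \<in> nb u \<and> y \<in> nb v"
begin

text \<open>
  These vertices lose their only relay to \<open>r\<close> when \<open>y\<close> has given its unit away.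
\<close>
definition private_nbs :: "'a \<Rightarrow> 'a \<Rightarrow> 'a set" where
  "private_nbs r y = {x. x \<noteq> r \<and> x \<notin> nb r \<and> nb x \<inter> nb r = {y}}"

lemma private_nb:
  assumes "x \<in> private_nbs r y"
  shows "x \<in> nb y" "y \<in> nb x" "y \<in> nb r" "x \<noteq> r" "x \<notin> nb r" "r \<notin> nb x"
  using assms nb_sym[of r x] nb_sym[of y x] by (auto simp: private_nbs_def)

lemma private_verts: "x \<in> private_nbs r y \<Longrightarrow> x \<in> pverts G"
  by (auto dest: private_nb nb_verts)

lemma private_unique: "\<lbrakk>x \<in> private_nbs r y; z \<in> nb x; z \<in> nb r\<rbrakk> \<Longrightarrow> z = y"
  by (auto simp: private_nbs_def)

text \<open>
  Once \<open>y\<close> has given its unit to \<open>r\<close>, every vertex at distance 2 outside \<open>private_nbs r y\<close> has a relay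
  other than \<open>y\<close>. When these are done, the neighbours of \<open>r\<close> follow. Any set containing
  \<open>private_nbs r y\<close> may be held back for later use.
\<close>
lemma concentrate_except_private:
  assumes y: "y \<in> nb r" and K: "K \<subseteq> pverts G - {r, y}" and priv: "private_nbs r y \<subseteq> K"
  shows "reach (initial_weight G) (concentrated r K)"
proof -
  have r: "r \<in> pverts G" "y \<in> pverts G" "y \<noteq> r" using y nb_verts nb_verts' by auto
  let ?K1 = "pverts G - {r} - {y}"
  let ?X = "?K1 - nb r - K"
  have "reach (concentrated r (pverts G - {r})) (concentrated r ?K1)"
    using y r by (intro concentrate_adjacent) auto
  moreover have "reach (concentrated r ?K1) (concentrated r (?K1 - ?X))"
  proof (rule concentrate_relay)
    have "pverts G - ?K1 = {r, y}" using r by auto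
    then show "2 \<le> card (pverts G - ?K1)" using r by simp
  next
    fix x assume x: "x \<in> ?X"
    then have "x \<notin> private_nbs r y" using priv by auto
    moreover obtain z where "z \<in> nb x" "z \<in> nb r" using common_nb[of x r] x r by auto
    ultimately obtain z where "z \<in> nb x" "z \<in> nb r" "z \<noteq> y"
      using x unfolding private_nbs_def by blast
    moreover from this have "z \<in> ?K1" using nb_verts by auto
    ultimately show "\<exists>z \<in> nb x \<inter> nb r. z \<in> ?K1" by blast
  qed (use r in auto)
  moreover have "reach (concentrated r (?K1 - ?X)) (concentrated r (?K1 - ?X - (?K1 \<inter> nb r - K)))"
    using r by (intro concentrate_adjacent) auto
  moreover have "?K1 - ?X - (?K1 \<inter> nb r - K) = K" using K by auto
  ultimately show ?thesis using initial_concentrated[OF r(1)] by simp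
qed

lemma unit_acquisition_number_eq_1:
  assumes "reach (initial_weight G) (concentrated r {})" "r \<in> pverts G"
  shows "unit_acquisition_number G = 1"
  using unit_acquisition_number_le[OF assms] unit_acquisition_number_pos[OF nonempty] by simp

end

text \<open>
  All structural facts about these graphs come from strategies that would gather everything at one
  vertex and that they must therefore defeat.
\<close>
locale stubborn_graph = diameter_le_2_graph +
  assumes stubborn: "unit_acquisition_number G \<noteq> 1"
begin

lemma private_nonempty:
  assumes "y \<in> nb r"
  shows "\<exists>x. x \<in> private_nbs r y"
  using concentrate_except_private[OF assms, of "{}"] unit_acquisition_number_eq_1[of r]
    stubborn nb_verts'[OF assms] by auto

text \<open>
  A private neighbour \<open>x\<close> has distance 2 from \<open>a\<close>, since \<open>y\<close> is its only neighbour adjacent to \<open>r\<close>. The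
  path from \<open>x\<close> to \<open>a\<close> cannot use \<open>y\<close> and so passes through a leaf of the branch at \<open>a\<close>.
\<close>
lemma private_detour:
  assumes "x \<in> private_nbs r y" "a \<in> nb r" "a \<noteq> y" "a \<notin> nb y"
  shows "\<exists>u. u \<in> nb x \<and> u \<in> nb a \<and> u \<noteq> r \<and> u \<notin> nb r"
proof -
  have "x \<noteq> a" "x \<notin> nb a" "x \<notin> nb r" using assms private_unique[of x r y a] nb_sym[of x a]
    by (auto simp: private_nbs_def)
  moreover have "x \<in> pverts G" "a \<in> pverts G" using assms private_nb nb_verts by blast+
  ultimately obtain u where u: "u \<in> nb x" "u \<in> nb a" using common_nb by blast
  have "u \<noteq> r" using u(1) \<open>x \<notin> nb r\<close> nb_sym by blast
  moreover have "u \<notin> nb r"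
    using private_unique[OF assms(1) u(1)] u(2) assms(4) nb_sym by blast
  ultimately show ?thesis using u by blast
qed

text \<open>
  Otherwise the root \<open>r\<close> would collect everything: first all units except those of \<open>a\<close>, \<open>b\<close>, the
  private neighbours of \<open>y\<close> and the leaves at \<open>a\<close>, then these by \<open>concentrate_branch\<close>. The vertex \<open>q\<close>
  is one that is collected in the first phase, so that \<open>r\<close>, \<open>y\<close> and \<open>q\<close> give the root the weight 3.
\<close>
lemma no_branch:
  assumes y: "y \<in> nb r" and a: "a \<in> nb r" "a \<noteq> y"
    and b: "b \<in> nb a" "b \<noteq> r" "b \<noteq> y" "b \<notin> private_nbs r y"
    and dom: "\<And>x. x \<in> private_nbs r y \<Longrightarrow> \<exists>u \<in> nb a. u \<noteq> r \<and> u \<notin> nb r \<and> u \<noteq> b \<and> u \<in> nb x"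
    and q: "q \<in> pverts G" "q \<notin> {r, y, a, b}" "q \<notin> private_nbs r y" "q \<notin> nb a \<or> q \<in> nb r"
  shows False
proof -
  let ?T = "nb a - insert r (nb r) - {b}"
  let ?K = "insert a (insert b (private_nbs r y \<union> ?T))"
  have P: "private_nbs r y \<subseteq> pverts G - {r, y, a, b}" "private_nbs r y \<inter> ?T = {}"
  proof -
    show "private_nbs r y \<subseteq> pverts G - {r, y, a, b}"
      using private_verts[of _ r y] y a b by (fastforce simp: private_nbs_def)
    show "private_nbs r y \<inter> ?T = {}" using private_unique a nb_sym by blast
  qed
  have K: "?K \<subseteq> pverts G - {r, y}" using P y a b nb_verts by auto
  have r: "r \<in> pverts G" "y \<in> pverts G" "r \<noteq> y" using y nb_verts nb_verts' by auto
  have 1: "reach (initial_weight G) (concentrated r ?K)"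
    by (rule concentrate_except_private[OF y K]) auto
  have "reach (concentrated r ?K) (concentrated r (?K - ?K))"
  proof (rule concentrate_branch)
    have "{r, y, q} \<subseteq> pverts G - ?K" using K q r by auto
    then have "card {r, y, q} \<le> card (pverts G - ?K)" using pair_finite_verts by (intro card_mono) auto
    moreover have "card {r, y, q} = 3" using q r by (auto simp: card_insert_if)
    ultimately show "3 \<le> card (pverts G - ?K)" by simp
  next
    fix x assume "x \<in> private_nbs r y"
    then show "\<exists>u \<in> ?T. u \<in> nb x" using dom by blast
  qed (use K P a b in auto)
  then have "reach (concentrated r ?K) (concentrated r {})" by (simp only: Diff_cancel)
  with 1 have "reach (initial_weight G) (concentrated r {})" by (rule rtranclp_trans)
  then show False using unit_acquisition_number_eq_1 r stubborn by blast
qed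

section \<open>Excluding short cycles\<close>

text \<open>
  In a triangle \<open>r, a, b\<close> choose \<open>y\<close> as a private neighbour of the arc from \<open>a\<close> to \<open>r\<close>, so that \<open>y\<close> is
  adjacent to \<open>r\<close> but not to \<open>a\<close>. All private neighbours of \<open>y\<close> have a detour through the leaves at \<open>a\<close>,
  and \<open>b\<close>, which is none of these leaves, is free to be sacrificed. A private neighbour of \<open>b\<close> supplies
  the third unit at the root.
\<close>
lemma triangle_free:
  assumes "a \<in> nb r" "b \<in> nb r" "b \<in> nb a"
  shows False
proof -
  obtain y where y: "y \<in> private_nbs a r" using private_nonempty[OF nb_sym[OF assms(1)]] by blast
  then have "y \<in> nb r" "y \<notin> nb a" "y \<noteq> a" using private_nb[OF y] by auto
  have "a \<noteq> b" "y \<noteq> b" using assms \<open>y \<notin> nb a\<close> by auto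
  obtain q where q: "q \<in> private_nbs r b" using private_nonempty[OF assms(2)] by blast
  show False
  proof (rule no_branch[of y r a b q])
    fix x assume "x \<in> private_nbs r y"
    moreover have "a \<notin> nb y" using \<open>y \<notin> nb a\<close> nb_sym by blast
    ultimately obtain u where "u \<in> nb x" "u \<in> nb a" "u \<noteq> r" "u \<notin> nb r"
      using private_detour[of x r y a] assms \<open>y \<noteq> a\<close> by auto
    then show "\<exists>u \<in> nb a. u \<noteq> r \<and> u \<notin> nb r \<and> u \<noteq> b \<and> u \<in> nb x" using assms by blast
  next
    show "q \<in> pverts G" using q private_nb nb_verts by blast
    show "q \<notin> {r, y, a, b}" using q assms \<open>y \<in> nb r\<close> by (auto simp: private_nbs_def)
    show "q \<notin> private_nbs r y" using q \<open>y \<noteq> b\<close> by (auto simp: private_nbs_def)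
    show "q \<notin> nb a \<or> q \<in> nb r" using private_unique[OF q] assms(1) \<open>a \<noteq> b\<close> nb_sym by blast
    show "b \<notin> private_nbs r y" using assms by (auto simp: private_nbs_def)
  qed (use assms \<open>y \<in> nb r\<close> \<open>y \<noteq> a\<close> \<open>y \<noteq> b\<close> in auto)
qed

text \<open>
  Sacrificing a leaf \<open>b\<close> at \<open>z\<close> must fail, so some private neighbour of \<open>y\<close> has \<open>b\<close> as its only common
  neighbour with \<open>z\<close>. Different leaves need different private neighbours.
\<close>
lemma card_branch_le_private:
  assumes y: "y \<in> nb r" "z \<in> nb r" "q \<in> nb r" "y \<noteq> z" "q \<noteq> y" "q \<noteq> z"
  shows "card (nb z - {r}) \<le> card (private_nbs r y)"
proof -
  have "\<exists>x. x \<in> private_nbs r y \<and> nb x \<inter> nb z = {b}" if b: "b \<in> nb z - {r}" for b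
  proof (rule ccontr)
    assume none: "\<not> ?thesis"
    have "b \<notin> nb r" "y \<notin> nb z" using b y triangle_free by auto
    show False
    proof (rule no_branch[of y r z b q])
      fix x assume x: "x \<in> private_nbs r y"
      have "z \<notin> nb y" using \<open>y \<notin> nb z\<close> nb_sym by blast
      then obtain u where u: "u \<in> nb x" "u \<in> nb z" "u \<noteq> r" "u \<notin> nb r"
        using private_detour[OF x, of z] y by auto
      moreover have "nb x \<inter> nb z \<noteq> {b}" using none x by blast
      ultimately obtain u where u: "u \<in> nb x" "u \<in> nb z" "u \<noteq> b" by blast
      moreover have "u \<noteq> r" using private_nb[OF x] u by auto
      moreover have "u \<notin> nb r" using u y triangle_free by blast
      ultimately show "\<exists>u \<in> nb z. u \<noteq> r \<and> u \<notin> nb r \<and> u \<noteq> b \<and> u \<in> nb x" by blast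
    next
      show "b \<notin> private_nbs r y" using private_unique[of b r y z] b y nb_sym by blast
      show "q \<notin> {r, y, z, b}" using y \<open>b \<notin> nb r\<close> by auto
      show "q \<notin> private_nbs r y" using y by (auto simp: private_nbs_def)
    qed (use y b \<open>b \<notin> nb r\<close> nb_verts in auto)
  qed
  then obtain f where f: "\<And>b. b \<in> nb z - {r} \<Longrightarrow> f b \<in> private_nbs r y \<and> nb (f b) \<inter> nb z = {b}" by metis
  have "inj_on f (nb z - {r})" by (rule inj_onI) (metis f singleton_inject)
  moreover have "f ` (nb z - {r}) \<subseteq> private_nbs r y" using f by blast
  moreover have "finite (private_nbs r y)" using private_nb by (auto intro: finite_subset[OF _ finite_nb[of y]])
  ultimately show ?thesis by (rule card_inj_on_le)
qed

text \<open>
  Take \<open>p\<close> as root. The preceding bound for \<open>u\<close> and \<open>v\<close> in both orders shows that all leaves at \<open>u\<close>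
  are private, but \<open>q\<close> is adjacent to both \<open>u\<close> and \<open>v\<close>. A private neighbour of the arc from \<open>u\<close> to
  \<open>p\<close> is the third neighbour of \<open>p\<close> that the bound requires.
\<close>
lemma four_cycle_free:
  assumes "p \<in> nb u" "p \<in> nb v" "q \<in> nb u" "q \<in> nb v" "u \<noteq> v"
  shows "p = q"
proof (rule ccontr)
  assume "p \<noteq> q"
  have uv: "u \<in> nb p" "v \<in> nb p" "u \<in> nb q" "v \<in> nb q" using assms nb_sym by auto
  obtain t where t: "t \<in> private_nbs u p" using private_nonempty[OF assms(1)] by blast
  have "t \<in> nb p" "t \<noteq> u" using private_nb[OF t] by auto
  moreover have "t \<noteq> v" using private_unique[OF t, of q] assms \<open>p \<noteq> q\<close> by auto
  ultimately have le: "card (nb v - {p}) \<le> card (private_nbs p u)" "card (nb u - {p}) \<le> card (private_nbs p v)"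
    using uv \<open>u \<noteq> v\<close> by (auto intro!: card_branch_le_private[of _ _ _ t])
  have "private_nbs p u \<subseteq> nb u - {p} - {q}"
    using private_nb[of _ p u] private_unique[of q p u v] uv assms by auto
  then have "card (private_nbs p u) \<le> card (nb u - {p} - {q})" by (intro card_mono) auto
  also have "\<dots> < card (nb u - {p})" using assms \<open>p \<noteq> q\<close> by (intro card_Diff1_less) auto
  finally have "card (private_nbs p u) < card (nb u - {p})" .
  moreover have "private_nbs p v \<subseteq> nb v - {p}" using private_nb[of _ p v] by blast
  then have "card (private_nbs p v) \<le> card (nb v - {p})" by (intro card_mono) auto
  ultimately show False using le by simp
qed

lemma nb_inter_nb:
  assumes "y \<in> nb r" "z \<in> nb r" "y \<noteq> z"
  shows "nb y \<inter> nb z = {r}"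
proof -
  have r: "r \<in> nb y" "r \<in> nb z" using assms nb_sym by auto
  then have "x = r" if "x \<in> nb y" "x \<in> nb z" for x
    using four_cycle_free[OF that(1) that(2) _ _ assms(3)] by blast
  then show ?thesis using r by blast
qed

lemma private_eq:
  assumes "y \<in> nb r"
  shows "private_nbs r y = nb y - {r}"
proof
  show "private_nbs r y \<subseteq> nb y - {r}" using private_nb[of _ r y] by blast
  show "nb y - {r} \<subseteq> private_nbs r y"
  proof
    fix x assume x: "x \<in> nb y - {r}"
    then have "y \<in> nb x" using nb_sym by auto
    moreover have "x \<notin> nb r" using x assms triangle_free by blast
    moreover have "z = y" if "z \<in> nb x" "z \<in> nb r" for z
      using four_cycle_free[of z x r y] that x assms \<open>y \<in> nb x\<close> by auto
    then have "nb x \<inter> nb r = {y}" using assms \<open>y \<in> nb x\<close> by blast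
    ultimately show "x \<in> private_nbs r y" using x by (simp add: private_nbs_def)
  qed
qed

text \<open>
  Send each neighbour of \<open>u\<close> that is not adjacent to \<open>v\<close> to its common neighbour with \<open>v\<close>. Without
  triangles and 4-cycles this is injective.
\<close>
lemma card_nb_le:
  assumes "u \<in> pverts G" "v \<in> pverts G" "u \<noteq> v" "u \<notin> nb v"
  shows "card (nb u) \<le> card (nb v)"
proof -
  have "\<exists>z. z \<in> nb v \<and> (if x \<in> nb v then z = x else z \<in> nb x)" if "x \<in> nb u" for x
  proof (cases "x \<in> nb v")
    case False
    moreover have "x \<noteq> v" using that assms nb_sym by blast
    ultimately show ?thesis using common_nb[of x v] nb_verts[OF that] assms by auto
  qed auto
  then obtain f where f: "\<And>x. x \<in> nb u \<Longrightarrow> f x \<in> nb v \<and> (if x \<in> nb v then f x = x else f x \<in> nb x)"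
    by metis
  have "inj_on f (nb u)"
  proof (rule inj_onI)
    fix x x' assume x: "x \<in> nb u" "x' \<in> nb u" "f x = f x'"
    have "f x \<noteq> u" using f[OF x(1)] assms by auto
    show "x = x'"
    proof (cases "x \<in> nb v"; cases "x' \<in> nb v")
      assume "x \<notin> nb v" "x' \<notin> nb v"
      then have "x \<in> nb (f x)" "x' \<in> nb (f x)"
        using f[of x] f[of x'] x nb_sym[of "f x" x] nb_sym[of "f x" x'] by auto
      then show ?thesis using four_cycle_free x \<open>f x \<noteq> u\<close> by blast
    next
      assume "x \<in> nb v" "x' \<notin> nb v"
      then have "x \<in> nb x'" using f[of x] f[of x'] x by auto
      then show ?thesis using triangle_free x by blast
    next
      assume "x \<notin> nb v" "x' \<in> nb v"
      then have "x' \<in> nb x" using f[of x] f[of x'] x by auto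
      then show ?thesis using triangle_free x by blast
    next
      assume "x \<in> nb v" "x' \<in> nb v"
      then have "f x = x" "f x' = x'" using f[OF x(1)] f[OF x(2)] by simp_all
      then show ?thesis using x(3) by metis
    qed
  qed
  moreover have "f ` nb u \<subseteq> nb v" using f by blast
  ultimately show ?thesis by (intro card_inj_on_le) auto
qed

text \<open>
  Nonadjacent vertices have equal degrees by symmetry of the previous bound. Adjacent vertices \<open>u\<close> and
  \<open>v\<close> lie on a 5-cycle, and the vertex opposite to their edge is adjacent to neither.
\<close>
lemma regular:
  assumes "u \<in> pverts G" "v \<in> pverts G"
  shows "card (nb u) = card (nb v)"
proof -
  have nonadj: "card (nb u) = card (nb v)"
    if "u \<in> pverts G" "v \<in> pverts G" "u \<notin> nb v" for u v
  proof (cases "u = v")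
    case False
    moreover have "v \<notin> nb u" using that nb_sym by blast
    ultimately show ?thesis using card_nb_le[of u v] card_nb_le[of v u] that by simp
  qed simp
  show ?thesis
  proof (cases "u \<in> nb v")
    case True
    obtain x where x: "x \<in> private_nbs v u" using private_nonempty[OF True] by blast
    then have "u \<in> nb x" "x \<noteq> v" using private_nb[OF x] by auto
    obtain z where z: "z \<in> private_nbs u x"
      using private_nonempty[OF private_nb(1)[OF x]] by blast
    have zx: "z \<in> nb x" "z \<notin> nb u" "z \<noteq> u" using private_nb[OF z] by auto
    then have "z \<notin> nb v" using four_cycle_free[of z x v u] \<open>u \<in> nb x\<close> \<open>x \<noteq> v\<close> True by auto
    then show ?thesis using nonadj[of z u] nonadj[of z v] zx assms nb_verts[of z x] by simp
  next
    case False
    then show ?thesis by (rule nonadj[OF assms])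
  qed
qed

section \<open>Degrees\<close>

text \<open>
  In girth 5 a leaf \<open>b\<close> at \<open>z\<close> is adjacent to at most one leaf \<open>a\<close> at \<open>y\<close>. After the sacrifice of \<open>b\<close> all
  private neighbours of \<open>y\<close> but \<open>a\<close> still have a detour through \<open>z\<close>. The set \<open>M\<close> is held back so that a
  further branch is available to rescue \<open>a\<close>.
\<close>
lemma concentrate_leaving_one:
  assumes y: "y \<in> nb r" "z \<in> nb r" "q \<in> nb r" "y \<noteq> z" "q \<noteq> y" "q \<noteq> z"
    and M: "M \<subseteq> pverts G - {r, y, z, q} - nb y - nb z"
  shows "\<exists>a \<in> private_nbs r y. reach (initial_weight G) (concentrated r (insert a M))"
proof -
  obtain b where "b \<in> private_nbs r z" using private_nonempty[OF y(2)] by blast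
  note b = private_nb[OF this]
  have disj: "nb y \<inter> nb z = {r}" using nb_inter_nb y by simp
  \<comment> \<open>If no private neighbour is adjacent to \<open>b\<close>, an arbitrary one serves as \<open>a\<close>.\<close>
  have "\<exists>a \<in> private_nbs r y. \<forall>x \<in> private_nbs r y. b \<in> nb x \<longrightarrow> x = a"
  proof (cases "\<exists>a \<in> private_nbs r y. b \<in> nb a")
    case True
    then obtain a where a: "a \<in> private_nbs r y" "b \<in> nb a" by blast
    have "b \<noteq> y" using b y by auto
    have "x = a" if "x \<in> private_nbs r y" "b \<in> nb x" for x
      using four_cycle_free[of x y b a] that a private_nb(1)[of _ r y] nb_sym[of b x] nb_sym[of b a]
        \<open>b \<noteq> y\<close> by auto
    then show ?thesis using a by blast
  next
    case False
    then show ?thesis using private_nonempty[OF y(1)] by blast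
  qed
  then obtain a where a: "a \<in> private_nbs r y" and
    uniq: "\<And>x. x \<in> private_nbs r y \<Longrightarrow> x \<noteq> a \<Longrightarrow> b \<notin> nb x" by blast
  let ?S = "private_nbs r y - {a}"
  let ?T = "nb z - {r, b}"
  let ?K = "insert a M \<union> insert z (insert b (?S \<union> ?T))"
  have r: "r \<in> pverts G" "y \<in> pverts G" "q \<in> pverts G" "r \<noteq> y" "r \<noteq> q" "r \<noteq> z" "z \<in> pverts G"
    using y nb_verts nb_verts' by auto
  have leaf: "x \<in> nb y \<and> x \<notin> nb r \<and> x \<noteq> r \<and> x \<noteq> z \<and> x \<noteq> b \<and> x \<notin> nb z" if "x \<in> private_nbs r y" for x
    using private_nb[OF that] y b disj by auto
  have zy: "y \<notin> nb z" "q \<notin> nb z" "q \<notin> nb y" using y triangle_free by blast+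
  have priv: "private_nbs r y \<subseteq> pverts G - {r, y, z, q, b}" using leaf private_verts y by blast
  have T: "insert b ?T \<subseteq> pverts G - {r, y, z, q}" using nb_verts[of _ z] b zy y by auto
  have K: "?K \<subseteq> pverts G - {r, y, q}" using M priv a T r y by auto
  have 1: "reach (initial_weight G) (concentrated r ?K)"
  proof (rule concentrate_except_private[OF y(1)])
    show "?K \<subseteq> pverts G - {r, y}" using K by blast
  qed auto
  have 2: "reach (concentrated r ?K) (concentrated r (?K - insert z (insert b (?S \<union> ?T))))"
  proof (rule concentrate_branch)
    have "{r, y, q} \<subseteq> pverts G - ?K" using K r by blast
    then have "card {r, y, q} \<le> card (pverts G - ?K)" using pair_finite_verts by (intro card_mono) auto
    moreover have "card {r, y, q} = 3" using y r by (auto simp: card_insert_if)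
    ultimately show "3 \<le> card (pverts G - ?K)" by simp
  next
    fix x assume x: "x \<in> ?S"
    have "z \<notin> nb y" using y triangle_free by blast
    then obtain u where u: "u \<in> nb x" "u \<in> nb z" "u \<noteq> r"
      using private_detour[of x r y z] x y by auto
    moreover have "u \<noteq> b" using uniq x u by blast
    ultimately show "\<exists>u \<in> ?T. u \<in> nb x" by blast
  next
    show "?K \<subseteq> pverts G - {r}" using K by blast
    show "?S \<subseteq> ?K - {z, b}" using leaf by blast
    show "?S \<inter> ?T = {}" using leaf by blast
  qed (use y b in auto)
  have "?K - insert z (insert b (?S \<union> ?T)) = insert a M"
  proof -
    have "a \<notin> insert z (insert b (?S \<union> ?T))" using leaf[OF a] by blast
    moreover have "x \<notin> insert z (insert b (?S \<union> ?T))" if "x \<in> M" for x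
    proof -
      have "x \<notin> nb y" "x \<notin> nb z" "x \<noteq> z" using that M by blast+
      then show ?thesis using b leaf by blast
    qed
    ultimately show ?thesis by blast
  qed
  with 1 2 have "reach (initial_weight G) (concentrated r (insert a M))"
    using rtranclp_trans by metis
  then show ?thesis using a by blast
qed

text \<open>
  After \<open>concentrate_leaving_one\<close> with the branch at \<open>t\<close> held back, that branch rescues the remaining
  vertex \<open>a\<close>: it links to \<open>t\<close> through a leaf \<open>u\<close>, and by regularity \<open>t\<close> has another leaf \<open>c\<close> to
  sacrifice.
\<close>
lemma no_four_neighbours:
  assumes sub: "{y, z, t, q} \<subseteq> nb r" and dist: "distinct [y, z, t, q]"
  shows False
proof -
  have yr: "y \<in> nb r" "z \<in> nb r" "q \<in> nb r" "t \<in> nb r" using sub by auto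
  have ne: "y \<noteq> z" "q \<noteq> y" "q \<noteq> z" "t \<noteq> y" "t \<noteq> z" "t \<noteq> q"
    using dist by auto
  have r: "r \<in> pverts G" "y \<in> pverts G" "z \<in> pverts G" "q \<in> pverts G" "t \<in> pverts G"
    "r \<noteq> y" "r \<noteq> z" "r \<noteq> q" "r \<noteq> t"
    using yr nb_verts nb_verts' by auto
  have nadj: "y \<notin> nb t" "z \<notin> nb t" "q \<notin> nb t" "t \<notin> nb y" "t \<notin> nb z"
    using yr triangle_free by blast+
  have disj: "nb y \<inter> nb t = {r}" "nb z \<inter> nb t = {r}"
    using nb_inter_nb[of y r t] nb_inter_nb[of z r t] yr ne by auto
  let ?M = "insert t (nb t - {r})"
  have M: "?M \<subseteq> pverts G - {r, y, z, q} - nb y - nb z"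
    using nb_verts[of _ t] nadj disj ne r by auto
  then obtain a where a: "a \<in> private_nbs r y"
    and first: "reach (initial_weight G) (concentrated r (insert a ?M))"
    using concentrate_leaving_one[OF yr(1-3) ne(1-3)] by blast
  note a' = private_nb[OF a]
  obtain u where u: "u \<in> nb a" "u \<in> nb t" "u \<noteq> r"
    using private_detour[OF a yr(4)] ne nadj by auto
  have "card {y, z, t, q} = 4" using distinct_card[OF dist] by simp
  then have "4 \<le> card (nb r)" using card_mono[OF finite_nb sub] by simp
  then have "4 \<le> card (nb t)" using regular[of r t] r by simp
  then have "\<not> nb t \<subseteq> {r, u}"
    using card_mono[of "{r, u}" "nb t"] card_insert_le_m1[of 2 "{u}" r] by auto
  then obtain c where c: "c \<in> nb t" "c \<noteq> r" "c \<noteq> u" by blast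
  have at: "a \<noteq> t" "a \<notin> nb t" using a' yr disj by auto
  let ?K = "insert a ?M"
  have K: "?K \<subseteq> pverts G - {r, y, z, q}"
  proof -
    have "a \<in> pverts G - {r, y, z, q}" using a' yr private_verts[OF a] by auto
    then show ?thesis using M by blast
  qed
  have "reach (concentrated r ?K) (concentrated r (?K - insert t (insert c ({a} \<union> (nb t - {r, c})))))"
  proof (rule concentrate_branch)
    have "{r, y, q} \<subseteq> pverts G - ?K" using K r by blast
    then have "card {r, y, q} \<le> card (pverts G - ?K)" using pair_finite_verts by (intro card_mono) auto
    moreover have "card {r, y, q} = 3" using ne r by (auto simp: card_insert_if)
    ultimately show "3 \<le> card (pverts G - ?K)" by simp
  next
    show "{a} \<subseteq> ?K - {t, c}" using at c by auto
    show "?K \<subseteq> pverts G - {r}" using K by blast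
    show "\<And>x. x \<in> {a} \<Longrightarrow> \<exists>u \<in> nb t - {r, c}. u \<in> nb x" using u c by auto
  qed (use yr c at in auto)
  moreover have "?K - insert t (insert c ({a} \<union> (nb t - {r, c}))) = {}" by auto
  ultimately have "reach (concentrated r ?K) (concentrated r {})" by (simp only:)
  with first have "reach (initial_weight G) (concentrated r {})" by (rule rtranclp_trans)
  then show False using unit_acquisition_number_eq_1 r stubborn by blast
qed

lemma exists_arc: "\<exists>r y. y \<in> nb r"
proof (rule ccontr)
  assume none: "\<not> ?thesis"
  obtain r where r: "r \<in> pverts G" using nonempty by blast
  have "v = r" if "v \<in> pverts G" for v using common_nb[OF that r] none by blast
  then have "pverts G - {r} = {}" by blast
  then have "initial_weight G = concentrated r {}" using initial_concentrated[OF r] by (simp only:)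
  then show False using unit_acquisition_number_eq_1[of r] stubborn r by simp
qed

lemma degree_2_or_3: "(\<forall>v \<in> pverts G. card (nb v) = 2) \<or> (\<forall>v \<in> pverts G. card (nb v) = 3)"
proof -
  obtain r y where y: "y \<in> nb r" using exists_arc by blast
  have r: "r \<in> pverts G" using nb_verts'[OF y] .
  obtain x where "x \<in> private_nbs y r" using private_nonempty[OF nb_sym[OF y]] by blast
  then have "{x, y} \<subseteq> nb r" "x \<noteq> y" using private_nb y by auto
  then have "2 \<le> card (nb r)" using card_mono[OF finite_nb, of "{x, y}" r] by simp
  moreover have "card (nb r) \<le> 3"
  proof (rule ccontr)
    assume "\<not> card (nb r) \<le> 3"
    then obtain F where F: "F \<subseteq> nb r" "card F = 4"
      using obtain_subset_with_card_n[of 4 "nb r"] by auto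
    obtain xs where xs: "set xs = F" "distinct xs"
      using finite_distinct_list[OF finite_subset[OF F(1) finite_nb]] by blast
    then have "length xs = 4" using F(2) distinct_card by fastforce
    then obtain a b c d where "xs = [a, b, c, d]"
      by (auto simp: length_Suc_conv eval_nat_numeral)
    then show False using F(1) xs no_four_neighbours[of a b c d r] by simp
  qed
  ultimately have "card (nb r) = 2 \<or> card (nb r) = 3" by linarith
  then show ?thesis using regular[OF _ r] by metis
qed

text \<open>
  In degree 2 the only private neighbour of \<open>y\<close> is left over; in degree 3 one of the two is rescued.
\<close>
lemma unit_acquisition_number_le_2: "unit_acquisition_number G \<le> 2"
proof -
  obtain r y where y: "y \<in> nb r" using exists_arc by blast
  have r: "r \<in> pverts G" "y \<in> pverts G" using nb_verts'[OF y] nb_verts[OF y] by auto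
  consider "card (nb y) = 2" | "card (nb r) = 3" using degree_2_or_3 r by auto
  then show ?thesis
  proof cases
    case 1
    have "private_nbs r y \<subseteq> pverts G - {r, y}"
      using private_verts[of _ r y] private_nb(4)[of _ r y] private_nb(1)[of y r y] by auto
    then have "reach (initial_weight G) (concentrated r (private_nbs r y))"
      by (rule concentrate_except_private[OF y]) auto
    moreover have "card (private_nbs r y) = 1"
      using 1 private_eq[OF y] nb_sym[OF y] by simp
    ultimately show ?thesis
      using unit_acquisition_number_le[of r "private_nbs r y"] r by (simp add: card_gt_0_iff[symmetric] card_ge_0_finite)
  next
    case 2
    then have "card (nb r - {y}) = 2" using y by simp
    then obtain z q where "nb r - {y} = {z, q}" "z \<noteq> q" by (auto simp: card_2_iff)
    then have "z \<in> nb r" "q \<in> nb r" "y \<noteq> z" "q \<noteq> y" "q \<noteq> z" by auto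
    then obtain a where "reach (initial_weight G) (concentrated r {a})"
      using concentrate_leaving_one[of y r z q "{}"] y by auto
    from unit_acquisition_number_le[OF this r(1)] show ?thesis by simp
  qed
qed

text \<open>
  Every leaf has a link into every other branch, and this forces the adjacencies in the two small cases.
\<close>
lemma branch_link:
  assumes "y \<in> nb r" "z \<in> nb r" "y \<noteq> z" "x \<in> nb y" "x \<noteq> r"
  shows "\<exists>u. u \<in> nb x \<and> u \<in> nb z \<and> u \<noteq> r"
proof -
  have "x \<in> private_nbs r y" using private_eq[OF assms(1)] assms by simp
  moreover have "z \<notin> nb y" using assms triangle_free by blast
  ultimately show ?thesis using private_detour[of x r y z] assms by blast
qed

lemma verts_layers:
  assumes "r \<in> pverts G"
  shows "pverts G = insert r (nb r \<union> (\<Union>y \<in> nb r. nb y))"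
proof
  show "pverts G \<subseteq> insert r (nb r \<union> (\<Union>y \<in> nb r. nb y))"
  proof
    fix v assume v: "v \<in> pverts G"
    show "v \<in> insert r (nb r \<union> (\<Union>y \<in> nb r. nb y))"
    proof (cases "v = r \<or> v \<in> nb r")
      case False
      then obtain y where "y \<in> nb v" "y \<in> nb r" using common_nb[OF v assms] by blast
      then have "v \<in> nb y" "y \<in> nb r" using nb_sym by auto
      then show ?thesis by blast
    qed auto
  qed
qed (use assms nb_verts in auto)

end

section \<open>The pentagon and the Petersen graph\<close>

lemma graph_isoI:
  assumes "pair_wf_digraph G" "inj_on f (pverts G)" "f ` pverts G = pverts H"
    and "map_prod f f ` parcs G = parcs H"
  shows "graph_iso G H"
proof -
  interpret pair_wf_digraph G by fact
  let ?h = "\<lparr>iso_verts = f, iso_arcs = map_prod f f, iso_head = snd, iso_tail = fst\<rparr>"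
  have "parcs G \<subseteq> pverts G \<times> pverts G" using in_arcsD1 in_arcsD2 by auto
  then have "inj_on (map_prod f f) (parcs G)"
    using map_prod_inj_on[OF assms(2) assms(2)] inj_on_subset by blast
  then have "pre_digraph.digraph_isomorphism (with_proj G) ?h"
    unfolding pre_digraph.digraph_isomorphism_def using assms(2) wf_digraph_axioms by simp
  moreover have "with_proj H = app_iso ?h (with_proj G)"
    using assms by (simp add: app_iso_def with_proj_def)
  ultimately show ?thesis unfolding graph_iso_def digraph_iso_def by blast
qed

text \<open>
  Neighbourhoods are what the structural argument determines, so isomorphisms are checked on them.
\<close>
lemma (in pair_graph) graph_iso_nbI:
  assumes "inj_on f (pverts G)" "f ` pverts G = pverts H" "fst ` parcs H \<subseteq> pverts H"
    and nb: "\<And>v. v \<in> pverts G \<Longrightarrow> f ` nb v = {B. (f v, B) \<in> parcs H}"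
  shows "graph_iso G H"
proof (rule graph_isoI)
  show "map_prod f f ` parcs G = parcs H"
  proof (intro equalityI subsetI)
    fix e assume "e \<in> map_prod f f ` parcs G"
    then obtain u v where e: "e = (f u, f v)" "v \<in> nb u" by (auto simp: nb_def)
    then have "f v \<in> f ` nb u" by blast
    then show "e \<in> parcs H" using e nb[OF nb_verts'] by auto
  next
    fix e assume e: "e \<in> parcs H"
    then obtain u where u: "u \<in> pverts G" "f u = fst e" using assms(2,3) by (metis image_iff subsetD)
    then have "snd e \<in> f ` nb u" using nb e by auto
    then obtain v where "v \<in> nb u" "snd e = f v" by blast
    then have "(u, v) \<in> parcs G" "e = map_prod f f (u, v)" using u by (auto simp: nb_def prod_eq_iff)
    then show "e \<in> map_prod f f ` parcs G" by blast
  qed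
qed (use assms in auto)

lemma cycle_graph_5_nb:
  "{j. (0, j) \<in> parcs (cycle_graph 5)} = {1, 4}"
  "{j. (1, j) \<in> parcs (cycle_graph 5)} = {0, 2}"
  "{j. (2, j) \<in> parcs (cycle_graph 5)} = {1, 3}"
  "{j. (3, j) \<in> parcs (cycle_graph 5)} = {4, 2}"
  "{j. (4, j) \<in> parcs (cycle_graph 5)} = {0, 3}"
proof -
  have lt: "j < 5 \<longleftrightarrow> j = 0 \<or> j = 1 \<or> j = 2 \<or> j = 3 \<or> j = 4" for j :: nat by auto
  show "{j. (0, j) \<in> parcs (cycle_graph 5)} = {1, 4}"
    "{j. (1, j) \<in> parcs (cycle_graph 5)} = {0, 2}"
    "{j. (2, j) \<in> parcs (cycle_graph 5)} = {1, 3}"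
    "{j. (3, j) \<in> parcs (cycle_graph 5)} = {4, 2}"
    "{j. (4, j) \<in> parcs (cycle_graph 5)} = {0, 3}"
    by (auto simp: cycle_graph_def lt)
qed

lemma petersen_verts:
  "pverts petersen_graph =
    {{0, 1}, {2, 3}, {2, 4}, {3, 4}, {0, 4}, {1, 4}, {1, 3}, {0, 3}, {1, 2}, {0, 2}}" (is "?L = ?R")
proof
  show "?L \<subseteq> ?R"
  proof
    fix A assume "A \<in> ?L"
    then obtain i j where "A = {i, j}" "i \<noteq> j" "i < 5" "j < 5"
      by (auto simp: petersen_graph_def card_2_iff)
    moreover have "i \<in> {0, 1, 2, 3, 4}" "j \<in> {0, 1, 2, 3, 4}" using calculation by auto
    ultimately show "A \<in> ?R" by (elim insertE) (auto simp: doubleton_eq_iff)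
  qed
  show "?R \<subseteq> ?L" by (auto simp: petersen_graph_def)
qed

lemma petersen_arcs:
  "(A, B) \<in> parcs petersen_graph \<longleftrightarrow>
    A \<in> pverts petersen_graph \<and> B \<in> pverts petersen_graph \<and> A \<inter> B = {}"
  by (auto simp: petersen_graph_def)

lemma petersen_nb:
  "{B. ({0, 1}, B) \<in> parcs petersen_graph} = {{2, 3}, {2, 4}, {3, 4}}"
  "{B. ({2, 3}, B) \<in> parcs petersen_graph} = {{0, 1}, {0, 4}, {1, 4}}"
  "{B. ({2, 4}, B) \<in> parcs petersen_graph} = {{0, 1}, {1, 3}, {0, 3}}"
  "{B. ({3, 4}, B) \<in> parcs petersen_graph} = {{0, 1}, {1, 2}, {0, 2}}"
  "{B. ({0, 4}, B) \<in> parcs petersen_graph} = {{2, 3}, {1, 3}, {1, 2}}"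
  "{B. ({1, 4}, B) \<in> parcs petersen_graph} = {{2, 3}, {0, 3}, {0, 2}}"
  "{B. ({1, 3}, B) \<in> parcs petersen_graph} = {{2, 4}, {0, 4}, {0, 2}}"
  "{B. ({0, 3}, B) \<in> parcs petersen_graph} = {{2, 4}, {1, 4}, {1, 2}}"
  "{B. ({1, 2}, B) \<in> parcs petersen_graph} = {{3, 4}, {0, 4}, {0, 3}}"
  "{B. ({0, 2}, B) \<in> parcs petersen_graph} = {{3, 4}, {1, 4}, {1, 3}}"
  unfolding petersen_arcs petersen_verts by auto

context stubborn_graph
begin

lemma nb_eq_2:
  assumes "card (nb v) = 2" "p \<in> nb v" "q \<in> nb v" "p \<noteq> q"
  shows "nb v = {p, q}"
proof -
  have "{p, q} \<subseteq> nb v" "card {p, q} = card (nb v)" using assms by auto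
  then show ?thesis using card_subset_eq[OF finite_nb] by metis
qed

lemma nb_eq_3:
  assumes "card (nb v) = 3" "p \<in> nb v" "q \<in> nb v" "s \<in> nb v" "p \<noteq> q" "p \<noteq> s" "q \<noteq> s"
  shows "nb v = {p, q, s}"
proof -
  have "{p, q, s} \<subseteq> nb v" "card {p, q, s} = card (nb v)" using assms by auto
  then show ?thesis using card_subset_eq[OF finite_nb] by metis
qed

lemma graph_iso_cycle_graph_5:
  assumes deg: "\<And>v. v \<in> pverts G \<Longrightarrow> card (nb v) = 2"
  shows "graph_iso G (cycle_graph 5)"
proof -
  obtain r where r: "r \<in> pverts G" using nonempty by blast
  obtain y z where nr: "nb r = {y, z}" "y \<noteq> z" using deg[OF r] by (auto simp: card_2_iff)
  then have yz: "y \<in> nb r" "z \<in> nb r" by auto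
  have sym: "r \<in> nb y" "r \<in> nb z" using yz nb_sym by auto
  have "card (nb y - {r}) = 1" using deg[OF nb_verts[OF yz(1)]] sym by simp
  then obtain x where "nb y - {r} = {x}" by (auto simp: card_1_singleton_iff)
  then have x: "x \<in> nb y" "x \<noteq> r" by auto
  obtain u where u: "u \<in> nb x" "u \<in> nb z" "u \<noteq> r" using branch_link[OF yz nr(2) x] by blast
  have xr: "x \<notin> nb r" "u \<notin> nb r" using triangle_free x u yz by blast+
  have xu: "x \<noteq> y" "x \<noteq> z" "u \<noteq> y" "u \<noteq> z" "x \<noteq> u" "y \<noteq> r" "z \<noteq> r"
    using xr yz u x by auto
  have nbs: "nb y = {r, x}" "nb z = {r, u}" "nb x = {y, u}" "nb u = {z, x}"
    using deg[OF nb_verts[OF yz(1)]] deg[OF nb_verts[OF yz(2)]]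
      deg[OF nb_verts[OF x(1)]] deg[OF nb_verts[OF u(1)]] sym x u xu
      nb_sym[OF x(1)] nb_sym[OF u(1)] nb_sym[OF u(2)]
    by - (rule nb_eq_2; auto)+
  have V: "pverts G = {r, y, x, u, z}" using verts_layers[OF r] nr nbs by auto
  let ?f = "(\<lambda>v. 0 :: nat)(y := 1, x := 2, u := 3, z := 4)"
  have f: "?f r = 0" "?f y = 1" "?f x = 2" "?f u = 3" "?f z = 4" using xu x u nr(2) by auto
  show ?thesis
  proof (rule graph_iso_nbI)
    show "inj_on ?f (pverts G)" unfolding inj_on_def V using f by simp
    show "?f ` pverts G = pverts (cycle_graph 5)"
      unfolding V image_insert f by (auto simp: cycle_graph_def)
    show "fst ` parcs (cycle_graph 5) \<subseteq> pverts (cycle_graph 5)" by (auto simp: cycle_graph_def)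
    fix v assume "v \<in> pverts G"
    then consider "v = r" | "v = y" | "v = x" | "v = u" | "v = z" using V by blast
    then show "?f ` nb v = {j. (?f v, j) \<in> parcs (cycle_graph 5)}"
      by cases (simp_all only: nr nbs image_insert image_empty f cycle_graph_5_nb)
  qed
qed

text \<open>
  Root the graph at \<open>r\<close> with neighbours \<open>y0, y1, y2\<close> and name the leaves at \<open>y0\<close> as \<open>a1, a2\<close>. Their links
  to the other branches name the leaves \<open>b1, b2\<close> and \<open>c1, c2\<close>. Finally \<open>b1\<close> must be linked to \<open>c2\<close> and \<open>b2\<close>
  to \<open>c1\<close>, because the alternative closes a triangle with \<open>a1\<close> or \<open>a2\<close>.
\<close>
lemma graph_iso_petersen_graph:
  assumes deg: "\<And>v. v \<in> pverts G \<Longrightarrow> card (nb v) = 3"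
  shows "graph_iso G petersen_graph"
proof -
  have deg': "card (nb v) = 3" if "v \<in> nb u" for u v using deg nb_verts that by blast
  obtain r where r: "r \<in> pverts G" using nonempty by blast
  obtain y0 y1 y2 where nr: "nb r = {y0, y1, y2}" and yne: "y0 \<noteq> y1" "y1 \<noteq> y2" "y0 \<noteq> y2"
    using deg[OF r] by (auto simp: card_3_iff)
  then have y: "y0 \<in> nb r" "y1 \<in> nb r" "y2 \<in> nb r" by auto
  have ry: "r \<in> nb y0" "r \<in> nb y1" "r \<in> nb y2" using y nb_sym by auto
  have "card (nb y0 - {r}) = 2" using deg'[OF y(1)] ry by simp
  then obtain a1 a2 where "nb y0 - {r} = {a1, a2}" and ane: "a1 \<noteq> a2" by (auto simp: card_2_iff)
  then have a: "a1 \<in> nb y0" "a2 \<in> nb y0" "a1 \<noteq> r" "a2 \<noteq> r" by auto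
  obtain b1 where b1: "b1 \<in> nb a1" "b1 \<in> nb y1" "b1 \<noteq> r" using branch_link[OF y(1,2) yne(1) a(1,3)] by blast
  obtain b2 where b2: "b2 \<in> nb a2" "b2 \<in> nb y1" "b2 \<noteq> r" using branch_link[OF y(1,2) yne(1) a(2,4)] by blast
  obtain c1 where c1: "c1 \<in> nb a1" "c1 \<in> nb y2" "c1 \<noteq> r" using branch_link[OF y(1,3) yne(3) a(1,3)] by blast
  obtain c2 where c2: "c2 \<in> nb a2" "c2 \<in> nb y2" "c2 \<noteq> r" using branch_link[OF y(1,3) yne(3) a(2,4)] by blast
  have leaf: "x \<notin> nb r" if "x \<in> nb v" "v \<in> nb r" for x v using that triangle_free by blast
  have far: "a1 \<notin> nb r" "a2 \<notin> nb r" "b1 \<notin> nb r" "b2 \<notin> nb r" "c1 \<notin> nb r" "c2 \<notin> nb r"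
    using leaf y a b1 b2 c1 c2 by auto
  have differ: "x \<noteq> x'" if "x \<in> nb v" "x \<noteq> r" "x' \<in> nb v'" "v \<in> nb r" "v' \<in> nb r" "v \<noteq> v'" for x x' v v'
    using nb_inter_nb[of v r v'] that by auto
  have layers: "a1 \<noteq> b1" "a1 \<noteq> b2" "a2 \<noteq> b1" "a2 \<noteq> b2" "a1 \<noteq> c1" "a1 \<noteq> c2" "a2 \<noteq> c1" "a2 \<noteq> c2"
    "b1 \<noteq> c1" "b1 \<noteq> c2" "b2 \<noteq> c1" "b2 \<noteq> c2"
    using differ a b1 b2 c1 c2 y yne by metis+
  have apart: "u \<noteq> u'" if "u \<in> nb a1" "u' \<in> nb a2" "u \<notin> nb r" for u u'
  proof
    assume "u = u'"
    then have "a1 \<in> nb u" "a2 \<in> nb u" "u \<noteq> y0" using that nb_sym y by auto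
    then show False using four_cycle_free[OF a(1) _ a(2)] ane by blast
  qed
  have bc: "b1 \<noteq> b2" "c1 \<noteq> c2" using apart b1 b2 c1 c2 far by blast+
  have ne: "r \<noteq> y0" "r \<noteq> y1" "r \<noteq> y2" using y by auto
  have yl: "y0 \<notin> {a1, a2, b1, b2, c1, c2}" "y1 \<notin> {a1, a2, b1, b2, c1, c2}"
    "y2 \<notin> {a1, a2, b1, b2, c1, c2}" using far y by auto
  have ny: "nb y0 = {r, a1, a2}" "nb y1 = {r, b1, b2}" "nb y2 = {r, c1, c2}"
    using ry a b1 b2 c1 c2 bc ane deg'[OF y(1)] deg'[OF y(2)] deg'[OF y(3)]
    by - (rule nb_eq_3; auto)+
  have na: "nb a1 = {y0, b1, c1}" "nb a2 = {y0, b2, c2}"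
    using nb_sym[OF a(1)] nb_sym[OF a(2)] b1 b2 c1 c2 yl layers deg'[OF a(1)] deg'[OF a(2)]
    by - (rule nb_eq_3; auto)+
  have "c1 \<notin> nb b1" "c2 \<notin> nb b2" using triangle_free b1 b2 c1 c2 by blast+
  then have "c2 \<in> nb b1" "c1 \<in> nb b2"
    using branch_link[OF y(2,3) yne(2) b1(2,3)] branch_link[OF y(2,3) yne(2) b2(2,3)] ny(3) by auto
  note cb = this this[THEN nb_sym]
  have nbc: "nb b1 = {y1, a1, c2}" "nb b2 = {y1, a2, c1}" "nb c1 = {y2, a1, b2}" "nb c2 = {y2, a2, b1}"
    using cb nb_sym[OF b1(1)] nb_sym[OF b1(2)] nb_sym[OF b2(1)] nb_sym[OF b2(2)]
      nb_sym[OF c1(1)] nb_sym[OF c1(2)] nb_sym[OF c2(1)] nb_sym[OF c2(2)] yl layers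
      deg'[OF b1(1)] deg'[OF b2(1)] deg'[OF c1(1)] deg'[OF c2(1)]
    by - (rule nb_eq_3; auto)+
  have V: "pverts G = {r, y0, y1, y2, a1, a2, b1, b2, c1, c2}"
    using verts_layers[OF r] nr ny by auto
  \<comment> \<open>Adjacent vertices receive disjoint pairs: \<open>r\<close> gets \<open>{0, 1}\<close>, its neighbours the pairs in \<open>{2, 3, 4}\<close>, and each leaf one element of either set.\<close>
  let ?f = "(\<lambda>v. {0, 1 :: nat})(y0 := {2, 3}, y1 := {2, 4}, y2 := {3, 4}, a1 := {0, 4}, a2 := {1, 4},
    b1 := {1, 3}, b2 := {0, 3}, c1 := {1, 2}, c2 := {0, 2})"
  have f: "?f r = {0, 1}" "?f y0 = {2, 3}" "?f y1 = {2, 4}" "?f y2 = {3, 4}" "?f a1 = {0, 4}"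
    "?f a2 = {1, 4}" "?f b1 = {1, 3}" "?f b2 = {0, 3}" "?f c1 = {1, 2}" "?f c2 = {0, 2}"
    using ne yne yl layers ane bc a b1 b2 c1 c2 by auto
  show ?thesis
  proof (rule graph_iso_nbI)
    show "inj_on ?f (pverts G)"
      unfolding inj_on_def V by (simp only: ball_simps f) (simp add: doubleton_eq_iff)
    show "?f ` pverts G = pverts petersen_graph"
      unfolding V image_insert f petersen_verts image_empty ..
    show "fst ` parcs petersen_graph \<subseteq> pverts petersen_graph" by (auto simp: petersen_graph_def)
    fix v assume "v \<in> pverts G"
    then consider "v = r" | "v = y0" | "v = y1" | "v = y2" | "v = a1" | "v = a2" | "v = b1" | "v = b2"
      | "v = c1" | "v = c2" using V by blast
    then show "?f ` nb v = {B. (?f v, B) \<in> parcs petersen_graph}"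
      by cases (simp_all only: nr ny na nbc image_insert image_empty f petersen_nb)
  qed
qed

end

section \<open>Graphs of diameter two\<close>

text \<open>
  With unit costs a walk of cost below 3 has at most two arcs. The infimum defining the distance is
  compared with 3, since a strict bound is what yields an actual walk.
\<close>
lemma (in pair_graph) graph_dist_le_2:
  assumes "graph_dist G u v \<le> 2" "u \<noteq> v" "u \<notin> nb v"
  shows "\<exists>y. y \<in> nb u \<and> y \<in> nb v"
proof -
  have "graph_dist G u v < 3" using assms(1) by (rule order.strict_trans1) simp
  then obtain p where p: "awalk u p v" "awalk_cost (\<lambda>_. 1) p < 3"
    unfolding graph_dist_def \<mu>_def by (auto simp: INF_less_iff)
  have "awalk_cost (\<lambda>_. 1) p = length p" by (simp add: awalk_cost_def sum_list_triv)
  then have "length p < 3" using p(2) by simp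
  then consider "p = []" | e where "p = [e]" | e e' where "p = [e, e']"
    by (cases p; cases "tl p"; cases "tl (tl p)") auto
  then show ?thesis
  proof cases
    case 1
    then show ?thesis using p assms by (simp add: awalk_Nil_iff)
  next
    case (2 e)
    then have "(u, v) \<in> parcs G" using p by (cases e) (auto simp: awalk_simps)
    then show ?thesis using assms nb_sym[of v u] by (simp add: nb_def)
  next
    case (3 e e')
    then have "(u, snd e) \<in> parcs G" "(snd e, v) \<in> parcs G"
      using p by (cases e; cases e'; auto simp: awalk_simps)+
    then show ?thesis using nb_sym[of v "snd e"] by (auto simp: nb_def)
  qed
qed

lemma diameter_le_2_graphI:
  fixes G :: "'a pair_pre_digraph"
  assumes "pair_graph G" and diam: "graph_diameter G = 2"
  shows "diameter_le_2_graph G"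
proof -
  interpret pair_graph G by fact
  have "graph_dist G u v \<le> 2" if "u \<in> pverts G" "v \<in> pverts G" for u v
    unfolding diam[symmetric] graph_diameter_def using that by (auto intro: SUP_upper2[of "(u, v)"])
  moreover have "pverts G \<noteq> {}" using diam by (auto simp: graph_diameter_def bot_ereal_def)
  ultimately show ?thesis by unfold_locales (use graph_dist_le_2 in blast)+
qed

theorem theorem5p2:
  fixes G :: "'a pair_pre_digraph"
  assumes "pair_graph G"
    and "graph_diameter G = 2"
  shows "unit_acquisition_number G \<le> 2
    \<and> (\<not> graph_iso G (cycle_graph 5) \<and> \<not> graph_iso G petersen_graph
        \<longrightarrow> unit_acquisition_number G = 1)
    \<and> (unit_acquisition_number G = 2
        \<longrightarrow> graph_iso G (cycle_graph 5) \<or> graph_iso G petersen_graph)"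
proof (cases "unit_acquisition_number G = 1")
  case False
  interpret diameter_le_2_graph G using diameter_le_2_graphI[OF assms] .
  interpret stubborn_graph G using False by unfold_locales
  have "graph_iso G (cycle_graph 5) \<or> graph_iso G petersen_graph"
    using degree_2_or_3 graph_iso_cycle_graph_5 graph_iso_petersen_graph by blast
  then show ?thesis using unit_acquisition_number_le_2 by blast
qed simp

end
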